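(* Fix any constant $\gamma>0$. In the Dual access model, there exists an $(\varepsilon_1,\varepsilon_2)$-tolerant tester for monotonicity of distributions over $[n]$ with query complexity $O\!\left(\frac{\log n}{\varepsilon_2^3}\right)$, provided $\varepsilon_2>(3+\gamma)\varepsilon_1$ (with $0\le\varepsilon_1<\varepsilon_2$).
   Context: A distribution over $[n]$ is monotone if $D(1)\ge\dots\ge D(n)$; $\mathcal{M}$ is the class of such distributions; $d_{TV}(D_1,D_2)=\frac12\sum_x|D_1(x)-D_2(x)|$, $d_{TV}(D,\mathcal{M})=\inf_{D'\in\mathcal{M}}d_{TV}(D,D')$. Dual access to $D$ consists of a sampling oracle ${\sf SAMP}$ (returns $x\in[n]$ with probability $D(x)$, independently of previous calls) and an evaluation oracle ${\sf EVAL}$ (on input $y\in[n]$ returns $D(y)$). An $(\varepsilon_1,\varepsilon_2)$-tolerant tester for monotonicity is a randomized algorithm which, given oracle access to $D$, outputs ACCEPT with probability at least $2/3$ if $d_{TV}(D,\mathcal{M})\le\varepsilon_1$, and REJECT with probability at least $2/3$ if $d_{TV}(D,\mathcal{M})>\varepsilon_2$. The hidden constant in $O(\cdot)$ may depend on $\gamma$. *)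

theory Defs
  imports "HOL-Probability.Probability"
begin

text \<open>The domain \<open>[n]\<close> is \<open>{1..n}\<close>.\<close>

definition dists :: "nat \<Rightarrow> nat pmf set" where
  "dists n = {D. set_pmf D \<subseteq> {1..n}}"

definition monotone_dists :: "nat \<Rightarrow> nat pmf set" where
  "monotone_dists n =
     {D \<in> dists n. \<forall>i\<in>{1..n}. \<forall>j\<in>{1..n}. i \<le> j \<longrightarrow> pmf D j \<le> pmf D i}"

definition d_TV :: "nat \<Rightarrow> nat pmf \<Rightarrow> nat pmf \<Rightarrow> real" where
  "d_TV n D1 D2 = 1/2 * (\<Sum>x\<in>{1..n}. \<bar>pmf D1 x - pmf D2 x\<bar>)"

text \<open>For \<open>n \<ge> 1\<close> the infimum is over a nonempty set that is bounded below by 0; for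
  \<open>n = 0\<close> there are no distributions and the value is unspecified.\<close>

definition dist_monotone :: "nat \<Rightarrow> nat pmf \<Rightarrow> real" where
  "dist_monotone n D = (INF D'\<in>monotone_dists n. d_TV n D D')"

datatype verdict = ACCEPT | REJECT

text \<open>Adaptive randomized algorithms with dual access, as well-founded trees. The continuations of
  \<open>SAMP\<close> and \<open>EVAL\<close> receive the oracle's answer; \<open>COINS p\<close> draws from the algorithm's own
  randomness (any discrete distribution) and is not a query.\<close>

datatype dual_alg =
    OUTPUT verdict
  | SAMP "nat \<Rightarrow> dual_alg"
  | EVAL nat "real \<Rightarrow> dual_alg"
  | COINS "nat pmf" "nat \<Rightarrow> dual_alg"

text \<open>Joint distribution of the verdict and the number of oracle queries made. A call of \<open>EVAL\<close>
  outside \<open>[n]\<close> is answered with 0 (and counted), so it reveals nothing.\<close>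

primrec run :: "nat pmf \<Rightarrow> dual_alg \<Rightarrow> (verdict \<times> nat) pmf" where
  "run D (OUTPUT v) = return_pmf (v, 0)"
| "run D (SAMP k) = bind_pmf D (\<lambda>x. map_pmf (apsnd Suc) (run D (k x)))"
| "run D (EVAL y k) = map_pmf (apsnd Suc) (run D (k (pmf D y)))"
| "run D (COINS p k) = bind_pmf p (\<lambda>r. run D (k r))"

definition prob_output :: "nat pmf \<Rightarrow> dual_alg \<Rightarrow> verdict \<Rightarrow> real" where
  "prob_output D A v = measure_pmf.prob (run D A) {(w, q). w = v}"

definition tolerant_monotonicity_tester :: "nat \<Rightarrow> real \<Rightarrow> real \<Rightarrow> dual_alg \<Rightarrow> bool" where
  "tolerant_monotonicity_tester n \<epsilon>\<^sub>1 \<epsilon>\<^sub>2 A \<longleftrightarrow>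
     (\<forall>D\<in>dists n.
        (dist_monotone n D \<le> \<epsilon>\<^sub>1 \<longrightarrow> prob_output D A ACCEPT \<ge> 2/3) \<and>
        (dist_monotone n D > \<epsilon>\<^sub>2 \<longrightarrow> prob_output D A REJECT \<ge> 2/3))"

text \<open>Worst case over all distributions on \<open>[n]\<close>, all oracle answers and all internal coins.\<close>

definition queries_at_most :: "nat \<Rightarrow> dual_alg \<Rightarrow> real \<Rightarrow> bool" where
  "queries_at_most n A b \<longleftrightarrow>
     (\<forall>D\<in>dists n. \<forall>(v, q)\<in>set_pmf (run D A). real q \<le> b)"

end

theory Submission
  imports Defs
begin

text \<open>
  Partition \<open>[n]\<close> into \<open>O(log n / \<delta>)\<close> buckets of geometrically growing length, where \<open>\<delta>\<close> is a
  small multiple of \<open>\<epsilon>\<^sub>2\<close>; replacing a monotone distribution by its bucket averages then moves it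
  by at most \<open>\<delta>\<close> (Birge). With \<open>O(log n / \<delta>\<^sup>3)\<close> samples all bucket weights of \<open>D\<close> are learnt up to
  total error \<open>\<delta>\<close>, and some bucketwise constant monotone \<open>M'\<close> whose weights are
  \<open>(\<epsilon>\<^sub>1 + 2\<delta>)\<close>-close to the learnt ones is taken as hypothesis. If \<open>D\<close> is \<open>\<epsilon>\<^sub>1\<close>-close to a
  monotone \<open>M\<close>, then going from \<open>D\<close> to \<open>M\<close>, to its flattening, to the learnt weights and to \<open>M'\<close>
  costs \<open>3\<epsilon>\<^sub>1 + O(\<delta>)\<close> in total. The distance of \<open>D\<close> to the explicit \<open>M'\<close> is the expectation
  under \<open>D\<close> of \<open>max 0 (1 - M' x / D x)\<close>, so \<open>O(1 / \<delta>\<^sup>2)\<close> samples and evaluations estimate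
  it. Soundness needs no learning guarantee: \<open>M'\<close> is monotone, so its distance to \<open>D\<close> is never below
  the distance of \<open>D\<close> to monotonicity.
\<close>

subsection \<open>Concentration of empirical means\<close>

lemma expectation_bind_finite:
  fixes h :: "'b \<Rightarrow> real"
  assumes "finite (set_pmf p)" "\<And>x. x \<in> set_pmf p \<Longrightarrow> finite (set_pmf (f x))"
  shows "measure_pmf.expectation (bind_pmf p f) h
       = measure_pmf.expectation p (\<lambda>x. measure_pmf.expectation (f x) h)"
  by (subst pmf_expectation_bind[where A = "set_pmf p"], use assms in auto)
    (subst integral_measure_pmf_real[where A = "set_pmf p"], use assms in \<open>auto simp: mult.commute\<close>)

lemma finite_set_replicate_pmf [simp]:
  "finite (set_pmf D) \<Longrightarrow> finite (set_pmf (replicate_pmf m D))"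
  by (induction m) auto

text \<open>Induction peeling off the first draw. In the square of the sum, the cross term is a
  product over independent draws, and it vanishes because the remaining sum has mean 0; this is why
  both moments are proved together.\<close>

lemma replicate_pmf_centred_moments:
  fixes g :: "'a \<Rightarrow> real"
  assumes fin: "finite (set_pmf D)" and zero: "measure_pmf.expectation D g = 0"
  shows "measure_pmf.expectation (replicate_pmf m D) (\<lambda>xs. \<Sum>x\<leftarrow>xs. g x) = 0"
    and "measure_pmf.expectation (replicate_pmf m D) (\<lambda>xs. (\<Sum>x\<leftarrow>xs. g x)\<^sup>2)
         = real m * measure_pmf.expectation D (\<lambda>x. (g x)\<^sup>2)"
proof (induction m)
  case (Suc m)
  note [simp] = integrable_measure_pmf_finite[OF fin]
    integrable_measure_pmf_finite[OF finite_set_replicate_pmf[OF fin]]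
  have step: "measure_pmf.expectation (replicate_pmf (Suc m) D) h
      = measure_pmf.expectation D (\<lambda>x. measure_pmf.expectation (replicate_pmf m D) (\<lambda>xs. h (x # xs)))"
    for h :: "'a list \<Rightarrow> real"
    using fin by (simp add: expectation_bind_finite)
  {
    case 1
    show ?case
      unfolding step using Suc zero by simp
  next
    case 2
    have "(\<Sum>y\<leftarrow>x # xs. g y)\<^sup>2 = (g x)\<^sup>2 + 2 * g x * (\<Sum>y\<leftarrow>xs. g y) + (\<Sum>y\<leftarrow>xs. g y)\<^sup>2"
      for x xs by (simp add: power2_sum)
    then show ?case
      unfolding step using Suc by (simp add: algebra_simps)
  }
qed auto

text \<open>Centring gives exactly \<open>m\<close> times the variance of \<open>f\<close>. Bounding
  the variance by the raw second moment lets the bounds for a whole family of functions be added up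
  under one pointwise hypothesis.\<close>

lemma replicate_pmf_second_moment:
  fixes f :: "'a \<Rightarrow> real"
  assumes fin: "finite (set_pmf D)"
  shows "measure_pmf.expectation (replicate_pmf m D)
           (\<lambda>xs. ((\<Sum>x\<leftarrow>xs. f x) - real m * measure_pmf.expectation D f)\<^sup>2)
         \<le> real m * measure_pmf.expectation D (\<lambda>x. (f x)\<^sup>2)"
proof -
  define \<mu> where "\<mu> = measure_pmf.expectation D f"
  note [simp] = integrable_measure_pmf_finite[OF fin]
  have zero: "measure_pmf.expectation D (\<lambda>x. f x - \<mu>) = 0"
    by (simp add: \<mu>_def)
  have "measure_pmf.expectation (replicate_pmf m D) (\<lambda>xs. ((\<Sum>x\<leftarrow>xs. f x) - real m * \<mu>)\<^sup>2)
      = measure_pmf.expectation (replicate_pmf m D) (\<lambda>xs. (\<Sum>x\<leftarrow>xs. f x - \<mu>)\<^sup>2)"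
    by (intro integral_cong_AE)
      (auto simp: AE_measure_pmf_iff set_replicate_pmf sum_list_subtractf sum_list_triv)
  also have "\<dots> = real m * measure_pmf.expectation D (\<lambda>x. (f x - \<mu>)\<^sup>2)"
    by (rule replicate_pmf_centred_moments(2)[OF fin zero])
  also have "measure_pmf.expectation D (\<lambda>x. (f x - \<mu>)\<^sup>2)
      = measure_pmf.expectation D (\<lambda>x. (f x)\<^sup>2) - \<mu>\<^sup>2"
    by (simp add: power2_diff) (simp add: \<mu>_def[symmetric] power2_eq_square mult.commute mult.left_commute)
  finally show ?thesis
    by (simp add: \<mu>_def mult_left_mono)
qed

text \<open>Chebyshev for the summed error of a family of means. Cauchy-Schwarz replaces the sum of
  absolute errors by \<open>card J\<close> times the sum of squares, Markov applies to the latter,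
  and the pointwise bound keeps its expectation at most \<open>m\<close>. Treating the family
  jointly avoids a union bound over \<open>J\<close>.\<close>

lemma empirical_means_concentrate:
  fixes f :: "'j \<Rightarrow> 'a \<Rightarrow> real"
  assumes fin: "finite (set_pmf D)" and "finite J" and "m > 0" "t > 0"
    and bound: "\<And>x. x \<in> set_pmf D \<Longrightarrow> (\<Sum>j\<in>J. (f j x)\<^sup>2) \<le> 1"
  shows "measure_pmf.prob (replicate_pmf m D)
           {xs. (\<Sum>j\<in>J. \<bar>(\<Sum>x\<leftarrow>xs. f j x) / real m - measure_pmf.expectation D (f j)\<bar>) \<ge> t}
         \<le> real (card J) / (real m * t\<^sup>2)"
proof -
  define R where "R = replicate_pmf m D"
  define Y where "Y = (\<lambda>j xs. (\<Sum>x\<leftarrow>xs. f j x) - real m * measure_pmf.expectation D (f j))"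
  note [simp] = integrable_measure_pmf_finite[OF fin]
    integrable_measure_pmf_finite[OF finite_set_replicate_pmf[OF fin]]
  have "{xs. (\<Sum>j\<in>J. \<bar>(\<Sum>x\<leftarrow>xs. f j x) / real m - measure_pmf.expectation D (f j)\<bar>) \<ge> t}
      \<subseteq> {xs. (\<Sum>j\<in>J. (Y j xs)\<^sup>2) * card J \<ge> (real m * t)\<^sup>2}"
  proof safe
    fix xs
    have "(\<Sum>j\<in>J. \<bar>(\<Sum>x\<leftarrow>xs. f j x) / real m - measure_pmf.expectation D (f j)\<bar>)
        = (\<Sum>j\<in>J. \<bar>Y j xs\<bar> / real m)"
      using \<open>m > 0\<close> by (intro sum.cong) (auto simp: Y_def field_simps)
    also have "\<dots> = (\<Sum>j\<in>J. \<bar>Y j xs\<bar>) / real m"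
      by (simp add: sum_divide_distrib)
    finally have eq: "(\<Sum>j\<in>J. \<bar>(\<Sum>x\<leftarrow>xs. f j x) / real m - measure_pmf.expectation D (f j)\<bar>)
        = (\<Sum>j\<in>J. \<bar>Y j xs\<bar>) / real m" .
    assume "t \<le> (\<Sum>j\<in>J. \<bar>(\<Sum>x\<leftarrow>xs. f j x) / real m - measure_pmf.expectation D (f j)\<bar>)"
    then have "real m * t \<le> (\<Sum>j\<in>J. \<bar>Y j xs\<bar>)"
      using \<open>m > 0\<close> unfolding eq by (simp add: field_simps)
    then have "(real m * t)\<^sup>2 \<le> (\<Sum>j\<in>J. \<bar>Y j xs\<bar>)\<^sup>2"
      using \<open>t > 0\<close> by (intro power_mono) auto
    also have "\<dots> \<le> (\<Sum>j\<in>J. (Y j xs)\<^sup>2) * card J"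
      using sum_squared_le_sum_of_squares[of "\<lambda>j. \<bar>Y j xs\<bar>" J] by simp
    finally show "(real m * t)\<^sup>2 \<le> (\<Sum>j\<in>J. (Y j xs)\<^sup>2) * card J" .
  qed
  then have "measure_pmf.prob R
        {xs. (\<Sum>j\<in>J. \<bar>(\<Sum>x\<leftarrow>xs. f j x) / real m - measure_pmf.expectation D (f j)\<bar>) \<ge> t}
      \<le> measure_pmf.prob R {xs. (\<Sum>j\<in>J. (Y j xs)\<^sup>2) * card J \<ge> (real m * t)\<^sup>2}"
    by (intro measure_pmf.finite_measure_mono) auto
  also have "\<dots> \<le> measure_pmf.expectation R (\<lambda>xs. (\<Sum>j\<in>J. (Y j xs)\<^sup>2) * card J) / (real m * t)\<^sup>2"
  proof -
    have nonneg: "AE xs in R. 0 \<le> (\<Sum>j\<in>J. (Y j xs)\<^sup>2) * card J"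
      by (intro AE_I2 mult_nonneg_nonneg sum_nonneg) auto
    show ?thesis
      using integral_Markov_inequality_measure[OF _ _ nonneg, of UNIV "(real m * t)\<^sup>2"] \<open>m > 0\<close> \<open>t > 0\<close>
      by (simp add: R_def)
  qed
  also have "measure_pmf.expectation R (\<lambda>xs. (\<Sum>j\<in>J. (Y j xs)\<^sup>2) * card J)
      = (\<Sum>j\<in>J. measure_pmf.expectation R (\<lambda>xs. (Y j xs)\<^sup>2)) * card J"
    by (simp add: R_def)
  also have "\<dots> \<le> (\<Sum>j\<in>J. real m * measure_pmf.expectation D (\<lambda>x. (f j x)\<^sup>2)) * card J"
    unfolding R_def Y_def
    by (intro mult_right_mono sum_mono replicate_pmf_second_moment fin) auto
  also have "(\<Sum>j\<in>J. real m * measure_pmf.expectation D (\<lambda>x. (f j x)\<^sup>2))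
      = real m * measure_pmf.expectation D (\<lambda>x. \<Sum>j\<in>J. (f j x)\<^sup>2)"
    by (simp add: sum_distrib_left)
  also have "measure_pmf.expectation D (\<lambda>x. \<Sum>j\<in>J. (f j x)\<^sup>2) \<le> measure_pmf.expectation D (\<lambda>x. 1)"
    by (intro integral_mono_AE) (auto simp: AE_measure_pmf_iff bound)
  finally show ?thesis
    using \<open>m > 0\<close> \<open>t > 0\<close>
    by (simp add: R_def divide_right_mono mult_left_mono mult_right_mono power2_eq_square field_simps)
qed

subsection \<open>Programs with dual access\<close>

text \<open>Composes the guarantees of two successive phases: \<open>G\<close> is the event that the
  first phase goes well, and the second phase is analysed only on \<open>G\<close>.\<close>

lemma prob_bind_pmf_ge:
  assumes "measure_pmf.prob p G \<ge> a" "b \<ge> 0"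
    and "\<And>x. x \<in> G \<Longrightarrow> x \<in> set_pmf p \<Longrightarrow> measure_pmf.prob (f x) S \<ge> b"
  shows "measure_pmf.prob (bind_pmf p f) S \<ge> a * b"
proof -
  have "ennreal (measure_pmf.prob p G * b) = (\<integral>\<^sup>+x. ennreal b * indicator G x \<partial>p)"
    using assms by (subst nn_integral_cmult_indicator)
      (auto simp: measure_pmf.emeasure_eq_measure ennreal_mult' mult.commute)
  also have "\<dots> \<le> (\<integral>\<^sup>+x. emeasure (f x) S \<partial>p)"
    using assms(3) by (intro nn_integral_mono_AE)
      (auto simp: AE_measure_pmf_iff measure_pmf.emeasure_eq_measure ennreal_leI split: split_indicator)
  also have "\<dots> = ennreal (measure_pmf.prob (bind_pmf p f) S)"
    by (simp flip: measure_pmf.emeasure_eq_measure)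
  finally have "measure_pmf.prob p G * b \<le> measure_pmf.prob (bind_pmf p f) S"
    by (simp add: ennreal_le_iff)
  moreover have "a * b \<le> measure_pmf.prob p G * b"
    using assms by (intro mult_right_mono) auto
  ultimately show ?thesis by linarith
qed

text \<open>Continuation-passing style: the rest of the algorithm receives the complete list of
  answers and may depend on it. The same holds for \<open>eval_points\<close>.\<close>

primrec draw_samples :: "nat \<Rightarrow> (nat list \<Rightarrow> dual_alg) \<Rightarrow> dual_alg" where
  "draw_samples 0 k = k []"
| "draw_samples (Suc m) k = SAMP (\<lambda>x. draw_samples m (\<lambda>xs. k (x # xs)))"

primrec eval_points :: "nat list \<Rightarrow> (real list \<Rightarrow> dual_alg) \<Rightarrow> dual_alg" where
  "eval_points [] k = k []"
| "eval_points (x # xs) k = EVAL x (\<lambda>d. eval_points xs (\<lambda>ds. k (d # ds)))"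

lemma run_draw_samples:
  "run D (draw_samples m k)
   = bind_pmf (replicate_pmf m D) (\<lambda>xs. map_pmf (apsnd ((+) m)) (run D (k xs)))"
proof (induction m arbitrary: k)
  case 0
  have "apsnd (\<lambda>a. a) = (id :: verdict \<times> nat \<Rightarrow> _)" by auto
  then show ?case by (simp add: bind_return_pmf pmf.map_id)
next
  case (Suc m)
  show ?case
    by (simp add: Suc map_bind_pmf bind_assoc_pmf bind_return_pmf pmf.map_comp comp_def apsnd_compose)
qed

lemma run_eval_points:
  "run D (eval_points xs k) = map_pmf (apsnd ((+) (length xs))) (run D (k (map (pmf D) xs)))"
proof (induction xs arbitrary: k)
  case Nil
  have "apsnd (\<lambda>a. a) = (id :: verdict \<times> nat \<Rightarrow> _)" by auto
  then show ?case by (simp add: pmf.map_id)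
next
  case (Cons x xs)
  then show ?case by (simp add: pmf.map_comp comp_def apsnd_compose)
qed

lemma prob_output_OUTPUT [simp]: "prob_output D (OUTPUT w) v = of_bool (w = v)"
  by (simp add: prob_output_def indicator_def)

lemma prob_output_eval_points [simp]:
  "prob_output D (eval_points xs k) v = prob_output D (k (map (pmf D) xs)) v"
  by (auto simp: prob_output_def run_eval_points vimage_def intro!: arg_cong[where f = "measure_pmf.prob _"])

lemma prob_output_draw_samples_ge:
  assumes "measure_pmf.prob (replicate_pmf m D) G \<ge> a" "b \<ge> 0"
    and "\<And>xs. xs \<in> G \<Longrightarrow> prob_output D (k xs) v \<ge> b"
  shows "prob_output D (draw_samples m k) v \<ge> a * b"
proof -
  have "(\<lambda>x. apsnd ((+) m) x) -` {(w, q). w = v} = {(w, q :: nat). w = v}"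
    by auto
  then show ?thesis
    unfolding prob_output_def run_draw_samples
    using assms by (intro prob_bind_pmf_ge) (auto simp: prob_output_def)
qed

lemma queries_at_most_OUTPUT [simp]: "queries_at_most n (OUTPUT v) b \<longleftrightarrow> (dists n = {} \<or> b \<ge> 0)"
  by (auto simp: queries_at_most_def)

lemma queries_at_most_draw_samples:
  assumes "\<And>xs. length xs = m \<Longrightarrow> queries_at_most n (k xs) b"
  shows "queries_at_most n (draw_samples m k) (real m + b)"
  using assms by (fastforce simp: queries_at_most_def run_draw_samples set_replicate_pmf)

lemma queries_at_most_eval_points:
  assumes "\<And>ds. queries_at_most n (k ds) b"
  shows "queries_at_most n (eval_points xs k) (real (length xs) + b)"
  using assms by (fastforce simp: queries_at_most_def run_eval_points)

subsection \<open>Total variation distance and bucketing\<close>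

lemma distsD: "D \<in> dists n \<Longrightarrow> x \<notin> {1..n} \<Longrightarrow> pmf D x = 0"
  by (auto simp: dists_def set_pmf_eq)

lemma finite_set_pmf_dists: "D \<in> dists n \<Longrightarrow> finite (set_pmf D)"
  by (auto simp: dists_def intro: finite_subset)

lemma sum_pmf_dists: "D \<in> dists n \<Longrightarrow> (\<Sum>x\<in>{1..n}. pmf D x) = 1"
  by (intro sum_pmf_eq_1) (auto simp: dists_def)

lemma monotone_dists_subset: "M \<in> monotone_dists n \<Longrightarrow> M \<in> dists n"
  by (simp add: monotone_dists_def)

text \<open>Beyond \<open>n\<close> all masses are 0, so \<open>y\<close> may exceed
  \<open>n\<close>. The Abel summation below uses this at \<open>Suc n\<close>.\<close>

lemma monotone_distsD:
  "M \<in> monotone_dists n \<Longrightarrow> 1 \<le> x \<Longrightarrow> x \<le> y \<Longrightarrow> pmf M y \<le> pmf M x"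
  by (cases "y \<le> n") (auto simp: monotone_dists_def distsD)

lemma d_TV_nonneg: "d_TV n P Q \<ge> 0"
  by (auto simp: d_TV_def intro: sum_nonneg)

lemma d_TV_triangle: "d_TV n P R \<le> d_TV n P Q + d_TV n Q R"
  by (auto simp: d_TV_def sum.distrib[symmetric] intro!: sum_mono)

lemma d_TV_le_1:
  assumes "P \<in> dists n" "Q \<in> dists n"
  shows "d_TV n P Q \<le> 1"
proof -
  have "(\<Sum>x\<in>{1..n}. \<bar>pmf P x - pmf Q x\<bar>) \<le> (\<Sum>x\<in>{1..n}. pmf P x + pmf Q x)"
    by (intro sum_mono) (simp add: abs_le_iff add_increasing add_increasing2)
  then show ?thesis
    using sum_pmf_dists[OF assms(1)] sum_pmf_dists[OF assms(2)] by (simp add: d_TV_def sum.distrib)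
qed

lemma monotone_dists_nonempty:
  assumes "n \<ge> 1"
  shows "return_pmf 1 \<in> monotone_dists n"
  using assms by (auto simp: monotone_dists_def dists_def indicator_def)

lemma dist_monotone_le: "M \<in> monotone_dists n \<Longrightarrow> dist_monotone n D \<le> d_TV n D M"
  unfolding dist_monotone_def by (intro cINF_lower bdd_belowI2[where m = 0]) (auto simp: d_TV_nonneg)

text \<open>A strict bound on the infimum yields a witness without any claim that the infimum is
  attained; completeness of the tester pays for this with one extra \<open>\<delta>\<close>.\<close>

lemma dist_monotone_lessE:
  assumes "n \<ge> 1" "dist_monotone n D < e"
  obtains M where "M \<in> monotone_dists n" "d_TV n D M < e"
  using assms monotone_dists_nonempty[OF assms(1)] unfolding dist_monotone_def
  by (subst (asm) cINF_less_iff) (auto simp: d_TV_nonneg intro: bdd_belowI2[where m = 0])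

text \<open>Both distributions have total mass 1, so the excess of \<open>D\<close> over
  \<open>M\<close> equals the excess of \<open>M\<close> over \<open>D\<close>, and each is half the
  L1 distance.\<close>

lemma d_TV_eq_sum_max:
  assumes "D \<in> dists n" "M \<in> dists n"
  shows "d_TV n D M = (\<Sum>x\<in>{1..n}. max 0 (pmf D x - pmf M x))"
proof -
  have "\<bar>pmf D x - pmf M x\<bar> = 2 * max 0 (pmf D x - pmf M x) - (pmf D x - pmf M x)" for x
    by (simp add: max_def)
  then show ?thesis
    using sum_pmf_dists[OF assms(1)] sum_pmf_dists[OF assms(2)]
    by (simp add: d_TV_def sum_subtractf flip: sum_distrib_left)
qed

text \<open>The right-hand side is what dual access lets one estimate; points with \<open>pmf D x = 0\<close>, where
  the quotient is the junk value 0, are never sampled.\<close>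

lemma d_TV_eq_expectation:
  assumes "D \<in> dists n" "M \<in> dists n"
  shows "d_TV n D M = measure_pmf.expectation D (\<lambda>x. max 0 (1 - pmf M x / pmf D x))"
proof -
  have "max 0 (1 - pmf M x / pmf D x) * pmf D x = max 0 (pmf D x - pmf M x)" for x
    by (cases "pmf D x = 0") (auto simp: max_def field_simps pmf_pos)
  moreover have "measure_pmf.expectation D (\<lambda>x. max 0 (1 - pmf M x / pmf D x))
      = (\<Sum>x\<in>{1..n}. max 0 (1 - pmf M x / pmf D x) * pmf D x)"
    using assms by (intro integral_measure_pmf_real) (auto simp: dists_def)
  ultimately show ?thesis
    using assms by (simp add: d_TV_eq_sum_max)
qed

section \<open>Partitions of the domain by a labelling, and flattening\<close>

definition bucket :: "(nat \<Rightarrow> nat) \<Rightarrow> nat \<Rightarrow> nat \<Rightarrow> nat set" where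
  "bucket b n j = {x \<in> {1..n}. b x = j}"

definition bucket_dist :: "(nat \<Rightarrow> nat) \<Rightarrow> nat \<Rightarrow> (nat \<Rightarrow> real) \<Rightarrow> (nat \<Rightarrow> real) \<Rightarrow> real" where
  "bucket_dist b n u v = 1/2 * (\<Sum>j\<in>b ` {1..n}. \<bar>u j - v j\<bar>)"

definition constant_on_buckets :: "(nat \<Rightarrow> nat) \<Rightarrow> nat \<Rightarrow> nat pmf \<Rightarrow> bool" where
  "constant_on_buckets b n P \<longleftrightarrow> (\<forall>x\<in>{1..n}. \<forall>y\<in>{1..n}. b x = b y \<longrightarrow> pmf P x = pmf P y)"

text \<open>The bucket averages of \<open>P\<close>, written as a two-stage draw so that the result
  is a distribution by construction; \<open>pmf_flatten\<close> recovers the averages.\<close>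

definition flatten :: "(nat \<Rightarrow> nat) \<Rightarrow> nat \<Rightarrow> nat pmf \<Rightarrow> nat pmf" where
  "flatten b n P = bind_pmf (map_pmf b P) (\<lambda>j. pmf_of_set (bucket b n j))"

lemma finite_bucket [simp]: "finite (bucket b n j)"
  by (simp add: bucket_def)

lemma support_in_bucket: "D \<in> dists n \<Longrightarrow> x \<in> set_pmf D \<Longrightarrow> x \<in> bucket b n (b x)"
  by (auto simp: dists_def bucket_def)

lemma bucket_nonempty: "j \<in> b ` {1..n} \<Longrightarrow> bucket b n j \<noteq> {}"
  by (auto simp: bucket_def)

lemma sum_by_buckets:
  fixes g :: "nat \<Rightarrow> real"
  shows "(\<Sum>x\<in>{1..n}. g x) = (\<Sum>j\<in>b ` {1..n}. \<Sum>x\<in>bucket b n j. g x)"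
  unfolding bucket_def by (rule sum.image_gen) simp

lemma bucket_dist_triangle: "bucket_dist b n u w \<le> bucket_dist b n u v + bucket_dist b n v w"
  by (auto simp: bucket_dist_def sum.distrib[symmetric] intro!: sum_mono)

lemma bucket_dist_commute: "bucket_dist b n u v = bucket_dist b n v u"
  by (simp add: bucket_dist_def abs_minus_commute)

lemma pmf_map_bucket:
  assumes "P \<in> dists n"
  shows "pmf (map_pmf b P) j = (\<Sum>x\<in>bucket b n j. pmf P x)"
proof -
  have "pmf (map_pmf b P) j = measure_pmf.prob P (bucket b n j)"
    unfolding pmf_map using support_in_bucket[OF assms]
    by (intro measure_pmf.finite_measure_eq_AE) (auto simp: AE_measure_pmf_iff bucket_def)
  then show ?thesis
    by (simp add: measure_measure_pmf_finite)
qed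

text \<open>The triangle inequality inside each bucket: merging points never increases the
  distance.\<close>

lemma bucket_dist_le_d_TV:
  assumes "P \<in> dists n" "Q \<in> dists n"
  shows "bucket_dist b n (pmf (map_pmf b P)) (pmf (map_pmf b Q)) \<le> d_TV n P Q"
  unfolding bucket_dist_def d_TV_def sum_by_buckets[where b = b] pmf_map_bucket[OF assms(1)]
    pmf_map_bucket[OF assms(2)] sum_subtractf[symmetric]
  by (intro mult_left_mono sum_mono sum_abs) auto

text \<open>Here the differences within a bucket all coincide, so nothing cancels when they are
  summed. Hence two bucketwise constant hypotheses can be compared through their bucket weights
  alone.\<close>

lemma d_TV_constant_on_buckets:
  assumes "P \<in> dists n" "Q \<in> dists n" "constant_on_buckets b n P" "constant_on_buckets b n Q"
  shows "d_TV n P Q = bucket_dist b n (pmf (map_pmf b P)) (pmf (map_pmf b Q))"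
proof -
  have "(\<Sum>x\<in>bucket b n j. \<bar>pmf P x - pmf Q x\<bar>) = \<bar>\<Sum>x\<in>bucket b n j. pmf P x - pmf Q x\<bar>" for j
  proof (cases "bucket b n j = {}")
    case False
    then obtain y where "y \<in> bucket b n j" by auto
    then have "pmf P x = pmf P y" "pmf Q x = pmf Q y" if "x \<in> bucket b n j" for x
      using that assms(3,4) by (auto simp: constant_on_buckets_def bucket_def)
    then show ?thesis by (simp add: abs_mult)
  qed auto
  then show ?thesis
    using assms unfolding d_TV_def sum_by_buckets[where b = b]
    by (simp add: bucket_dist_def pmf_map_bucket sum_subtractf)
qed

lemma flatten_dists:
  assumes "P \<in> dists n"
  shows "flatten b n P \<in> dists n"
proof -
  have "set_pmf (pmf_of_set (bucket b n (b x))) \<subseteq> {1..n}" if "x \<in> set_pmf P" for x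
    using support_in_bucket[OF assms that, of b] by (subst set_pmf_of_set) (auto simp: bucket_def)
  then show ?thesis
    by (force simp: dists_def flatten_def)
qed

lemma map_pmf_flatten:
  assumes "P \<in> dists n"
  shows "map_pmf b (flatten b n P) = map_pmf b P"
proof -
  have "map_pmf b (pmf_of_set (bucket b n (b x))) = return_pmf (b x)" if "x \<in> set_pmf P" for x
  proof -
    have "bucket b n (b x) \<noteq> {}"
      using support_in_bucket[OF assms that, of b] by blast
    then have "map_pmf b (pmf_of_set (bucket b n (b x))) = map_pmf (\<lambda>_. b x) (pmf_of_set (bucket b n (b x)))"
      by (intro map_pmf_cong refl) (auto simp: bucket_def)
    then show ?thesis by simp
  qed
  then show ?thesis
    unfolding flatten_def map_bind_pmf bind_map_pmf
    by (simp add: map_pmf_def cong: bind_pmf_cong)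
qed

lemma pmf_flatten:
  assumes "P \<in> dists n" "x \<in> {1..n}"
  shows "pmf (flatten b n P) x = pmf (map_pmf b P) (b x) / card (bucket b n (b x))"
proof -
  have "pmf (flatten b n P) x
      = measure_pmf.expectation (map_pmf b P) (\<lambda>j. pmf (pmf_of_set (bucket b n j)) x)"
    by (simp add: flatten_def pmf_bind)
  also have "\<dots> = (\<Sum>j\<in>{b x}. pmf (pmf_of_set (bucket b n j)) x * pmf (map_pmf b P) j)"
  proof (rule integral_measure_pmf_real)
    fix j assume "j \<in> set_pmf (map_pmf b P)" and nz: "pmf (pmf_of_set (bucket b n j)) x \<noteq> 0"
    \<comment> \<open>\<open>pmf_of_set\<close> is unspecified on the empty set, so empty buckets
      must be excluded through the support of \<open>map_pmf b P\<close>.\<close>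
    then have "bucket b n j \<noteq> {}"
      using support_in_bucket[OF assms(1), of _ b] by fastforce
    then show "j \<in> {b x}"
      using nz by (auto simp: bucket_def indicator_def split: if_splits)
  qed simp
  also have "\<dots> = pmf (map_pmf b P) (b x) / card (bucket b n (b x))"
  proof -
    have x: "x \<in> bucket b n (b x)" using assms by (simp add: bucket_def)
    then have "bucket b n (b x) \<noteq> {}" by blast
    then show ?thesis using x by (simp add: pmf_of_set)
  qed
  finally show ?thesis .
qed

lemma constant_on_buckets_flatten: "P \<in> dists n \<Longrightarrow> constant_on_buckets b n (flatten b n P)"
  by (auto simp: constant_on_buckets_def pmf_flatten)

text \<open>Since \<open>b\<close> is monotone, every point of an earlier bucket precedes every
  point of a later one. Multiplying both averages by the two cardinalities turns them into double
  sums over pairs, which compare termwise.\<close>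

lemma flatten_monotone:
  assumes M: "M \<in> monotone_dists n" and b: "mono_on {1..n} b"
  shows "flatten b n M \<in> monotone_dists n"
proof -
  note MD = monotone_dists_subset[OF M]
  have "pmf (flatten b n M) y \<le> pmf (flatten b n M) x"
    if xy: "x \<in> {1..n}" "y \<in> {1..n}" "x \<le> y" for x y
  proof (cases "b x = b y")
    case True
    then show ?thesis using xy MD by (simp add: pmf_flatten)
  next
    case False
    define I where "I = bucket b n (b x)"
    define I' where "I' = bucket b n (b y)"
    have "b x < b y"
      using False xy mono_onD[OF b, of x y] by simp
    have le: "pmf M v \<le> pmf M u" if "u \<in> I" "v \<in> I'" for u v
    proof (rule monotone_distsD[OF M])
      show "1 \<le> u" using that by (simp add: I_def bucket_def)
      show "u \<le> v"
      proof (rule ccontr)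
        assume "\<not> u \<le> v"
        then have "b v \<le> b u"
          using that by (intro mono_onD[OF b]) (auto simp: I_def I'_def bucket_def)
        then show False
          using \<open>b x < b y\<close> that by (auto simp: I_def I'_def bucket_def)
      qed
    qed
    have "x \<in> I" "y \<in> I'" and fin: "finite I" "finite I'"
      using xy by (auto simp: I_def I'_def bucket_def)
    then have pos: "card I > 0" "card I' > 0"
      by (auto simp: card_gt_0_iff)
    have "card I * (\<Sum>v\<in>I'. pmf M v) = (\<Sum>u\<in>I. \<Sum>v\<in>I'. pmf M v)"
      by simp
    also have "\<dots> \<le> (\<Sum>u\<in>I. \<Sum>v\<in>I'. pmf M u)"
      by (intro sum_mono le)
    also have "\<dots> = card I' * (\<Sum>u\<in>I. pmf M u)"
      by (simp add: sum_distrib_left)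
    finally have "(\<Sum>v\<in>I'. pmf M v) / card I' \<le> (\<Sum>u\<in>I. pmf M u) / card I"
      using pos by (simp add: field_simps)
    then show ?thesis
      using xy MD by (simp add: pmf_flatten pmf_map_bucket I_def I'_def)
  qed
  then show ?thesis
    using flatten_dists[OF MD] by (simp add: monotone_dists_def)
qed

lemma d_TV_flatten_le:
  fixes \<alpha> :: real
  assumes M: "M \<in> monotone_dists n" and b: "mono_on {1..n} b" and "\<alpha> \<ge> 0"
    and gap: "\<And>x y. x \<in> {1..n} \<Longrightarrow> y \<in> {1..n} \<Longrightarrow> x \<le> y \<Longrightarrow> b x = b y \<Longrightarrow> real y - real x \<le> \<alpha> * x"
  shows "d_TV n M (flatten b n M) \<le> \<alpha>"
proof -
  note MD = monotone_dists_subset[OF M]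
  \<comment> \<open>On a bucket \<open>{s..t}\<close> half the summed deviation from the average is at most
    \<open>(t - s) * (M s - M t) \<le> \<alpha> * s * (M s - M t)\<close>; Abel summation bounds the total of
    \<open>s * (M s - M t)\<close> over all buckets by the total mass 1.\<close>
  define drop where "drop = (\<lambda>z. real z * (pmf M z - pmf M (Suc z)))"
  have drop_nonneg: "drop z \<ge> 0" for z
    using monotone_distsD[OF M, of z "Suc z"] by (cases "z = 0") (auto simp: drop_def)
  \<comment> \<open>Each telescoped difference carries the weight \<open>s\<close>, which is at most
    the weight \<open>z\<close> inside \<open>drop z\<close>.\<close>
  have telescope: "real s * (pmf M s - pmf M t) \<le> (\<Sum>z\<in>{s..<t}. drop z)" if "1 \<le> s" "s \<le> t" for s t
    using that(2)
  proof (induction t rule: dec_induct)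
    case (step k)
    have "real s * (pmf M k - pmf M (Suc k)) \<le> drop k"
      using step that monotone_distsD[OF M, of k "Suc k"] by (auto simp: drop_def intro!: mult_right_mono)
    then show ?case
      using step by (simp add: algebra_simps)
  qed simp
  have bucket_bound: "1/2 * (\<Sum>x\<in>bucket b n j. \<bar>pmf M x - pmf (flatten b n M) x\<bar>)
      \<le> \<alpha> * (\<Sum>z\<in>bucket b n j. drop z)" if "j \<in> b ` {1..n}" for j
  proof -
    define I where "I = bucket b n j"
    define s where "s = Min I"
    define t where "t = Max I"
    have fin: "finite I" and ne: "I \<noteq> {}"
      using that by (auto simp: I_def bucket_nonempty)
    have s: "s \<in> I" and t: "t \<in> I" and range: "\<And>x. x \<in> I \<Longrightarrow> s \<le> x \<and> x \<le> t"
      using fin ne by (auto simp: s_def t_def)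
    then have "s \<le> t" and st: "s \<in> {1..n}" "t \<in> {1..n}" "b s = j" "b t = j"
      by (auto simp: I_def bucket_def)
    have I_eq: "I = {s..t}"
    proof
      show "{s..t} \<subseteq> I"
      proof
        fix z assume z: "z \<in> {s..t}"
        then have "b s \<le> b z" "b z \<le> b t"
          using st mono_onD[OF b, of s z] mono_onD[OF b, of z t] by auto
        then show "z \<in> I" using z st by (auto simp: I_def bucket_def)
      qed
    qed (use range in auto)
    define avg where "avg = (\<Sum>x\<in>I. pmf M x) / card I"
    have avg: "pmf (flatten b n M) x = avg" if "x \<in> I" for x
      using that MD by (auto simp: avg_def pmf_flatten pmf_map_bucket I_def bucket_def)
    have between: "pmf M t \<le> pmf M x \<and> pmf M x \<le> pmf M s" if "x \<in> I" for x
      using range[OF that] st by (intro conjI monotone_distsD[OF M]) auto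
    have "card I > 0" using fin ne by (simp add: card_gt_0_iff)
    moreover have "(\<Sum>x\<in>I. pmf M x) \<le> card I * pmf M s" "card I * pmf M t \<le> (\<Sum>x\<in>I. pmf M x)"
      using between by (auto intro!: sum_bounded_above sum_bounded_below)
    ultimately have "pmf M t \<le> avg" "avg \<le> pmf M s"
      by (simp_all add: avg_def pos_le_divide_eq pos_divide_le_eq mult.commute)
    then have "\<bar>pmf M x - pmf (flatten b n M) x\<bar> \<le> pmf M s - pmf M t" if "x \<in> I" for x
      using between[OF that] unfolding avg[OF that] abs_le_iff by linarith
    then have "(\<Sum>x\<in>I. \<bar>pmf M x - pmf (flatten b n M) x\<bar>) \<le> card I * (pmf M s - pmf M t)"
      by (rule sum_bounded_above)
    \<comment> \<open>\<open>card I = t - s + 1\<close> is at most \<open>2 * (t - s)\<close> unless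
      the bucket is a single point, where both sides are 0. The factor 2 is absorbed by the
      \<open>1/2\<close> in \<open>d_TV\<close>.\<close>
    also have "\<dots> \<le> 2 * (real t - real s) * (pmf M s - pmf M t)"
    proof (cases "s = t")
      case False
      then have "real (card I) \<le> 2 * (real t - real s)"
        using \<open>s \<le> t\<close> by (auto simp: I_eq)
      then show ?thesis
        using between[OF s] between[OF t] by (intro mult_right_mono) auto
    qed simp
    also have "\<dots> \<le> 2 * (\<alpha> * s) * (pmf M s - pmf M t)"
      using gap[OF st(1,2) \<open>s \<le> t\<close>] st between[OF s] by (intro mult_right_mono) auto
    also have "\<dots> = 2 * \<alpha> * (s * (pmf M s - pmf M t))"
      by simp
    also have "\<dots> \<le> 2 * \<alpha> * (\<Sum>z\<in>{s..<t}. drop z)"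
      using telescope[of s t] st \<open>s \<le> t\<close> \<open>\<alpha> \<ge> 0\<close> by (intro mult_left_mono) auto
    also have "\<dots> \<le> 2 * \<alpha> * (\<Sum>z\<in>I. drop z)"
      using \<open>\<alpha> \<ge> 0\<close> drop_nonneg by (intro mult_left_mono sum_mono2) (auto simp: I_eq)
    finally show ?thesis by (simp add: I_def)
  qed
  \<comment> \<open>At \<open>k = n\<close> this is the total mass 1 minus a nonnegative boundary
    term.\<close>
  have abel: "(\<Sum>z\<in>{1..k}. drop z) = (\<Sum>z\<in>{1..k}. pmf M z) - k * pmf M (Suc k)" for k
    by (induction k) (auto simp: drop_def algebra_simps)
  have "d_TV n M (flatten b n M)
      = (\<Sum>j\<in>b ` {1..n}. 1/2 * (\<Sum>x\<in>bucket b n j. \<bar>pmf M x - pmf (flatten b n M) x\<bar>))"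
    unfolding d_TV_def sum_by_buckets[where b = b] by (simp add: sum_distrib_left)
  also have "\<dots> \<le> (\<Sum>j\<in>b ` {1..n}. \<alpha> * (\<Sum>z\<in>bucket b n j. drop z))"
    by (rule sum_mono) (rule bucket_bound)
  also have "\<dots> = \<alpha> * (\<Sum>z\<in>{1..n}. drop z)"
    unfolding sum_by_buckets[where b = b] by (simp add: sum_distrib_left)
  also have "\<dots> \<le> \<alpha> * 1"
    unfolding abel sum_pmf_dists[OF MD] using \<open>\<alpha> \<ge> 0\<close> by (intro mult_left_mono) auto
  finally show ?thesis by simp
qed

section \<open>Buckets of geometrically growing length\<close>

definition log_bucket :: "real \<Rightarrow> nat \<Rightarrow> nat" where
  "log_bucket \<alpha> x = nat \<lfloor>ln (real x) / ln (1 + \<alpha>)\<rfloor>"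

lemma mono_on_log_bucket: "\<alpha> > 0 \<Longrightarrow> mono_on {1..n} (log_bucket \<alpha>)"
  by (auto simp: mono_on_def log_bucket_def intro!: nat_mono floor_mono divide_right_mono)

text \<open>Equal floors put the logarithms to base \<open>1 + \<alpha>\<close> within 1 of each
  other, so \<open>y\<close> is at most \<open>(1 + \<alpha>) * x\<close>.\<close>

lemma log_bucket_gap:
  assumes "\<alpha> > 0" "1 \<le> x" "x \<le> y" "log_bucket \<alpha> x = log_bucket \<alpha> y"
  shows "real y - real x \<le> \<alpha> * x"
proof -
  have pos: "ln (1 + \<alpha>) > 0" "ln (real x) \<ge> 0" "ln (real y) \<ge> 0"
    using assms by auto
  then have "\<lfloor>ln (real x) / ln (1 + \<alpha>)\<rfloor> = \<lfloor>ln (real y) / ln (1 + \<alpha>)\<rfloor>"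
    using assms(4) by (simp add: log_bucket_def eq_nat_nat_iff)
  then have "ln (real y) / ln (1 + \<alpha>) \<le> ln (real x) / ln (1 + \<alpha>) + 1"
    by linarith
  then have "ln (real y) \<le> ln (real x) + ln (1 + \<alpha>)"
    using pos by (simp add: field_simps)
  also have "\<dots> = ln (real x * (1 + \<alpha>))"
    using assms by (simp add: ln_mult)
  finally have "real y \<le> real x * (1 + \<alpha>)"
    using assms by (subst (asm) ln_le_cancel_iff) auto
  then show ?thesis by (simp add: algebra_simps)
qed

text \<open>For \<open>\<alpha>\<close> up to \<open>1/2\<close>, \<open>ln (1 + \<alpha>)\<close>
  is at least \<open>\<alpha> - \<alpha>\<^sup>2\<close>, hence at least
  \<open>\<alpha> / 2\<close>. The summand 1 accounts for the label 0.\<close>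

lemma card_log_bucket_le:
  assumes "0 < \<alpha>" "\<alpha> \<le> 1/2" "n \<ge> 1"
  shows "card (log_bucket \<alpha> ` {1..n}) \<le> 2 * ln (real n) / \<alpha> + 1"
proof -
  have "\<alpha> / 2 \<le> ln (1 + \<alpha>)"
  proof -
    have "\<alpha>\<^sup>2 \<le> \<alpha> * (1/2)"
      unfolding power2_eq_square using assms by (intro mult_left_mono) auto
    moreover have "\<alpha> - \<alpha>\<^sup>2 \<le> ln (1 + \<alpha>)"
      using assms by (intro ln_one_plus_pos_lower_bound) auto
    ultimately show ?thesis by simp
  qed
  then have "ln (real n) / ln (1 + \<alpha>) \<le> ln (real n) / (\<alpha> / 2)"
    using assms by (intro divide_left_mono) auto
  moreover have "log_bucket \<alpha> ` {1..n} \<subseteq> {..log_bucket \<alpha> n}"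
    using mono_on_log_bucket[of \<alpha> n] assms by (auto simp: mono_on_def)
  then have "card (log_bucket \<alpha> ` {1..n}) \<le> card {..log_bucket \<alpha> n}"
    by (intro card_mono) auto
  moreover have "real (log_bucket \<alpha> n) \<le> ln (real n) / ln (1 + \<alpha>)"
    using assms by (simp add: log_bucket_def of_nat_nat)
  ultimately show ?thesis by (simp add: mult.commute)
qed

subsection \<open>The tester\<close>

text \<open>The average is the empirical counterpart of the expectation in
  \<open>d_TV_eq_expectation\<close>. The hypothesis \<open>M\<close> is known explicitly, so only
  values of \<open>D\<close> are queried.\<close>

definition verify :: "nat pmf \<Rightarrow> nat \<Rightarrow> real \<Rightarrow> dual_alg" where
  "verify M r thr = draw_samples r (\<lambda>ys. eval_points ys (\<lambda>ds.
     OUTPUT (if (\<Sum>(y, d)\<leftarrow>zip ys ds. max 0 (1 - pmf M y / d)) / real r \<le> thr then ACCEPT else REJECT)))"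

text \<open>Assumption \<open>v\<close> says that every estimate with error below
  \<open>\<delta>\<close> leads to verdict \<open>v\<close>, so one statement serves both acceptance
  and rejection. The estimated function takes values in \<open>[0,1]\<close>, and Chebyshev gives
  failure probability at most \<open>1 / (r * \<delta>\<^sup>2)\<close>.\<close>

lemma prob_verify_ge:
  assumes D: "D \<in> dists n" and M: "M \<in> dists n" and "\<delta> > 0" and r: "real r \<ge> 6 / \<delta>\<^sup>2"
    and v: "\<And>z. \<bar>z - d_TV n D M\<bar> < \<delta> \<Longrightarrow> (if z \<le> thr then ACCEPT else REJECT) = v"
  shows "prob_output D (verify M r thr) v \<ge> 5/6"
proof -
  \<comment> \<open>A family with a single member, indexed by \<open>unit\<close>, to fit the
    concentration lemma.\<close>
  define f where "f = (\<lambda>(_::unit) x. max 0 (1 - pmf M x / pmf D x))"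
  define bad where "bad = {ys. (\<Sum>j\<in>{()}. \<bar>(\<Sum>x\<leftarrow>ys. f j x) / real r - measure_pmf.expectation D (f j)\<bar>) \<ge> \<delta>}"
  have "0 < 6 / \<delta>\<^sup>2" using \<open>\<delta> > 0\<close> by simp
  then have "real r > 0" using r by linarith
  have "measure_pmf.prob (replicate_pmf r D) bad \<le> real (card {()}) / (real r * \<delta>\<^sup>2)"
    unfolding bad_def
  proof (rule empirical_means_concentrate)
    fix x
    have "0 \<le> f () x" "f () x \<le> 1" by (auto simp: f_def)
    then show "(\<Sum>j\<in>{()}. (f j x)\<^sup>2) \<le> 1" by (simp add: power_le_one)
  qed (use \<open>real r > 0\<close> \<open>\<delta> > 0\<close> finite_set_pmf_dists[OF D] in auto)
  also have "\<dots> \<le> 1/6"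
    using r \<open>real r > 0\<close> \<open>\<delta> > 0\<close> by (simp add: field_simps)
  finally have "measure_pmf.prob (replicate_pmf r D) (- bad) \<ge> 5/6"
    by (simp add: measure_pmf.prob_compl[of bad, simplified] Compl_eq_Diff_UNIV)
  then have "prob_output D (verify M r thr) v \<ge> 5/6 * 1"
    unfolding verify_def
  proof (rule prob_output_draw_samples_ge)
    fix ys assume "ys \<in> - bad"
    then have "\<bar>(\<Sum>x\<leftarrow>ys. f () x) / real r - d_TV n D M\<bar> < \<delta>"
      by (simp add: bad_def d_TV_eq_expectation[OF D M] f_def)
    from v[OF this]
    show "1 \<le> prob_output D (eval_points ys (\<lambda>ds. OUTPUT (if (\<Sum>(y, d)\<leftarrow>zip ys ds.
        max 0 (1 - pmf M y / d)) / real r \<le> thr then ACCEPT else REJECT))) v"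
      by (simp add: zip_map2 zip_same_conv_map comp_def f_def)
  qed simp
  then show ?thesis by simp
qed

lemma queries_verify:
  assumes "n \<ge> 1"
  shows "queries_at_most n (verify M r thr) (2 * real r)"
proof -
  have "queries_at_most n (verify M r thr) (real r + real r)"
    unfolding verify_def
  proof (rule queries_at_most_draw_samples)
    fix ys :: "nat list" assume "length ys = r"
    then show "queries_at_most n (eval_points ys (\<lambda>ds. OUTPUT (if (\<Sum>(y, d)\<leftarrow>zip ys ds.
        max 0 (1 - pmf M y / d)) / real r \<le> thr then ACCEPT else REJECT))) (real r)"
      using queries_at_most_eval_points[of n _ 0 ys] by simp
  qed
  then show ?thesis by simp
qed

section \<open>Learning the bucket weights and choosing a hypothesis\<close>

definition empirical :: "(nat \<Rightarrow> nat) \<Rightarrow> nat \<Rightarrow> nat list \<Rightarrow> nat \<Rightarrow> real" where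
  "empirical b m xs j = (\<Sum>x\<leftarrow>xs. of_bool (b x = j)) / real m"

text \<open>At each point at most one bucket indicator is 1, so the pointwise hypothesis of the
  concentration lemma holds. The threshold there is \<open>2 * \<delta>\<close> because
  \<open>bucket_dist\<close> carries the factor \<open>1/2\<close>.\<close>

lemma prob_empirical_close:
  assumes D: "D \<in> dists n" and "\<delta> > 0" "m > 0"
    and m: "real m \<ge> 3 * real (card (b ` {1..n})) / (2 * \<delta>\<^sup>2)"
  shows "measure_pmf.prob (replicate_pmf m D)
           {xs. bucket_dist b n (empirical b m xs) (pmf (map_pmf b D)) < \<delta>} \<ge> 5/6"
proof -
  define J where "J = b ` {1..n}"
  define f where "f = (\<lambda>j x. of_bool (b x = j) :: real)"
  define bad where "bad = {xs. (\<Sum>j\<in>J. \<bar>(\<Sum>x\<leftarrow>xs. f j x) / real m - measure_pmf.expectation D (f j)\<bar>) \<ge> 2 * \<delta>}"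
  have "measure_pmf.prob (replicate_pmf m D) bad \<le> real (card J) / (real m * (2 * \<delta>)\<^sup>2)"
    unfolding bad_def
  proof (rule empirical_means_concentrate)
    fix x
    have "(\<Sum>j\<in>J. (f j x)\<^sup>2) = (\<Sum>j\<in>J. if b x = j then 1 else 0)"
      by (intro sum.cong) (auto simp: f_def)
    also have "\<dots> \<le> 1"
      by (subst sum.delta') (auto simp: J_def)
    finally show "(\<Sum>j\<in>J. (f j x)\<^sup>2) \<le> 1" .
  qed (use \<open>m > 0\<close> \<open>\<delta> > 0\<close> finite_set_pmf_dists[OF D] in \<open>auto simp: J_def\<close>)
  also have "\<dots> \<le> 1/6"
    using m \<open>m > 0\<close> \<open>\<delta> > 0\<close> by (simp add: field_simps J_def)
  finally have "measure_pmf.prob (replicate_pmf m D) (- bad) \<ge> 5/6"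
    by (simp add: measure_pmf.prob_compl[of bad, simplified] Compl_eq_Diff_UNIV)
  moreover have "measure_pmf.expectation D (f j) = pmf (map_pmf b D) j" for j
  proof -
    have "f j = indicator (b -` {j})"
      by (auto simp: f_def indicator_def)
    then show ?thesis by (simp add: pmf_map)
  qed
  then have "- bad = {xs. bucket_dist b n (empirical b m xs) (pmf (map_pmf b D)) < \<delta>}"
    by (auto simp: bad_def bucket_dist_def empirical_def f_def J_def)
  ultimately show ?thesis by simp
qed

definition candidate :: "(nat \<Rightarrow> nat) \<Rightarrow> nat \<Rightarrow> (nat \<Rightarrow> real) \<Rightarrow> real \<Rightarrow> nat pmf \<Rightarrow> bool" where
  "candidate b n u e M \<longleftrightarrow> M \<in> monotone_dists n \<and> constant_on_buckets b n M \<and> bucket_dist b n u (pmf (map_pmf b M)) \<le> e"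

text \<open>Since only oracle queries are counted, the hypothesis may be picked by \<open>SOME\<close>.\<close>

definition tester :: "(nat \<Rightarrow> nat) \<Rightarrow> nat \<Rightarrow> nat \<Rightarrow> nat \<Rightarrow> real \<Rightarrow> real \<Rightarrow> dual_alg" where
  "tester b n m r e thr = draw_samples m (\<lambda>xs.
     if \<exists>M. candidate b n (empirical b m xs) e M
     then verify (SOME M. candidate b n (empirical b m xs) e M) r thr
     else OUTPUT REJECT)"

lemma queries_tester:
  assumes "n \<ge> 1"
  shows "queries_at_most n (tester b n m r e thr) (real m + 2 * real r)"
  unfolding tester_def using queries_verify[OF assms]
  by (intro queries_at_most_draw_samples) auto

text \<open>The bound holds for every outcome of the learning phase: without a candidate the verdict
  is REJECT at once, and with one the true distance is at least \<open>thr + \<delta>\<close>, so an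
  estimate with error below \<open>\<delta>\<close> stays above \<open>thr\<close>.\<close>

lemma tester_rejects:
  assumes D: "D \<in> dists n" and "\<delta> > 0" and r: "real r \<ge> 6 / \<delta>\<^sup>2"
    and far: "dist_monotone n D \<ge> thr + \<delta>"
  shows "prob_output D (tester b n m r e thr) REJECT \<ge> 5/6"
proof -
  have verify: "prob_output D (verify M r thr) REJECT \<ge> 5/6" if "M \<in> monotone_dists n" for M
    using dist_monotone_le[OF that, of D] far
    by (intro prob_verify_ge[OF D monotone_dists_subset[OF that] \<open>\<delta> > 0\<close> r]) auto
  have "prob_output D (tester b n m r e thr) REJECT \<ge> 1 * (5/6)"
    unfolding tester_def
  proof (rule prob_output_draw_samples_ge[where G = UNIV])
    fix xs
    show "5/6 \<le> prob_output D (if \<exists>M. candidate b n (empirical b m xs) e M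
        then verify (SOME M. candidate b n (empirical b m xs) e M) r thr else OUTPUT REJECT) REJECT"
    proof (cases "\<exists>M. candidate b n (empirical b m xs) e M")
      case True
      moreover have "(SOME M. candidate b n (empirical b m xs) e M) \<in> monotone_dists n"
        using someI_ex[OF True] unfolding candidate_def by blast
      ultimately show ?thesis
        using verify by simp
    qed simp
  qed auto
  then show ?thesis by simp
qed

text \<open>Both phases succeed with probability at least \<open>5/6 * (5/6) = 25/36\<close>, which
  exceeds \<open>2/3\<close>.\<close>

lemma tester_accepts:
  assumes D: "D \<in> dists n" and "n \<ge> 1" and "\<delta> > 0" and r: "real r \<ge> 6 / \<delta>\<^sup>2"
    and "m > 0" and m: "real m \<ge> 3 * real (card (b ` {1..n})) / (2 * \<delta>\<^sup>2)"
    and b: "mono_on {1..n} b"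
    and flatten: "\<And>M. M \<in> monotone_dists n \<Longrightarrow> d_TV n M (flatten b n M) \<le> \<delta>"
    and close: "dist_monotone n D \<le> \<epsilon>"
  shows "prob_output D (tester b n m r (\<epsilon> + 2 * \<delta>) (3 * \<epsilon> + 7 * \<delta>)) ACCEPT \<ge> 2/3"
proof -
  obtain M where M: "M \<in> monotone_dists n" and DM: "d_TV n D M < \<epsilon> + \<delta>"
    using dist_monotone_lessE[OF \<open>n \<ge> 1\<close>, of D "\<epsilon> + \<delta>"] close \<open>\<delta> > 0\<close> by force
  note MD = monotone_dists_subset[OF M]
  define F where "F = flatten b n M"
  have F: "F \<in> monotone_dists n" "F \<in> dists n" "constant_on_buckets b n F" "map_pmf b F = map_pmf b M"
    unfolding F_def using flatten_monotone[OF M b] flatten_dists[OF MD] constant_on_buckets_flatten[OF MD]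
      map_pmf_flatten[OF MD] by auto
  have "prob_output D (tester b n m r (\<epsilon> + 2 * \<delta>) (3 * \<epsilon> + 7 * \<delta>)) ACCEPT \<ge> 5/6 * (5/6)"
    unfolding tester_def
  proof (rule prob_output_draw_samples_ge[OF prob_empirical_close[OF D \<open>\<delta> > 0\<close> \<open>m > 0\<close> m]])
    fix xs
    define u where "u = empirical b m xs"
    assume "xs \<in> {xs. bucket_dist b n (empirical b m xs) (pmf (map_pmf b D)) < \<delta>}"
    then have "bucket_dist b n u (pmf (map_pmf b D)) < \<delta>"
      by (simp add: u_def)
    \<comment> \<open>From \<open>u\<close> to the weights of \<open>D\<close> costs
      \<open>\<delta>\<close>, from there to those of \<open>M\<close> at most
      \<open>\<epsilon> + \<delta>\<close>, and flattening keeps the weights of \<open>M\<close>. So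
      \<open>F\<close> is a candidate, although the one chosen may differ.\<close>
    then have uF: "bucket_dist b n u (pmf (map_pmf b F)) \<le> \<epsilon> + 2 * \<delta>"
      using bucket_dist_triangle[of b n u "pmf (map_pmf b M)" "pmf (map_pmf b D)"]
        bucket_dist_le_d_TV[OF D MD, of b] DM unfolding F(4) by linarith
    then have ex: "\<exists>M. candidate b n u (\<epsilon> + 2 * \<delta>) M"
      using F by (auto simp: candidate_def)
    define M' where "M' = (SOME M. candidate b n u (\<epsilon> + 2 * \<delta>) M)"
    have "candidate b n u (\<epsilon> + 2 * \<delta>) M'"
      unfolding M'_def using ex by (rule someI_ex)
    then have M': "M' \<in> dists n" "constant_on_buckets b n M'"
      and uM': "bucket_dist b n u (pmf (map_pmf b M')) \<le> \<epsilon> + 2 * \<delta>"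
      by (auto simp: candidate_def monotone_dists_subset)
    have "d_TV n F M' \<le> bucket_dist b n (pmf (map_pmf b F)) u + bucket_dist b n u (pmf (map_pmf b M'))"
      unfolding d_TV_constant_on_buckets[OF F(2) M'(1) F(3) M'(2)] by (rule bucket_dist_triangle)
    also have "\<dots> \<le> (\<epsilon> + 2 * \<delta>) + (\<epsilon> + 2 * \<delta>)"
      using uF uM' by (intro add_mono) (simp_all add: bucket_dist_commute)
    finally have "d_TV n F M' \<le> 2 * \<epsilon> + 4 * \<delta>" by simp
    \<comment> \<open>The path is \<open>D\<close> to \<open>M\<close>
      (\<open>\<epsilon> + \<delta>\<close>), \<open>M\<close> to \<open>F\<close>
      (\<open>\<delta>\<close>), \<open>F\<close> to \<open>M'\<close>
      (\<open>2 * \<epsilon> + 4 * \<delta>\<close>). The seventh \<open>\<delta>\<close> in the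
      threshold covers the estimation error.\<close>
    then have "d_TV n D M' \<le> 3 * \<epsilon> + 6 * \<delta>"
      using DM flatten[OF M] d_TV_triangle[of n D M' M] d_TV_triangle[of n M M' F]
      unfolding F_def by linarith
    then have "5/6 \<le> prob_output D (verify M' r (3 * \<epsilon> + 7 * \<delta>)) ACCEPT"
      by (intro prob_verify_ge[OF D M'(1) \<open>\<delta> > 0\<close> r]) auto
    then show "5/6 \<le> prob_output D (if \<exists>M. candidate b n (empirical b m xs) (\<epsilon> + 2 * \<delta>) M
        then verify (SOME M. candidate b n (empirical b m xs) (\<epsilon> + 2 * \<delta>) M) r (3 * \<epsilon> + 7 * \<delta>)
        else OUTPUT REJECT) ACCEPT"
      using ex by (simp add: M'_def u_def)
  qed simp
  then show ?thesis by simp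
qed

section \<open>Choice of sample sizes and the query count\<close>

lemma tester_exists:
  assumes "n \<ge> 2" "0 < \<delta>" "\<delta> \<le> 1/2" "\<epsilon>\<^sub>2 \<ge> 3 * \<epsilon>\<^sub>1 + 8 * \<delta>"
  shows "\<exists>A. tolerant_monotonicity_tester n \<epsilon>\<^sub>1 \<epsilon>\<^sub>2 A \<and> queries_at_most n A (36 * ln (real n) / \<delta> ^ 3)"
proof -
  define b where "b = log_bucket \<delta>"
  define K where "K = real (card (b ` {1..n}))"
  define m where "m = nat \<lceil>3 * K / (2 * \<delta>\<^sup>2)\<rceil>"
  define r where "r = nat \<lceil>6 / \<delta>\<^sup>2\<rceil>"
  define A where "A = tester b n m r (\<epsilon>\<^sub>1 + 2 * \<delta>) (3 * \<epsilon>\<^sub>1 + 7 * \<delta>)"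
  have "K > 0"
    using \<open>n \<ge> 2\<close> by (auto simp: K_def card_gt_0_iff)
  then have m_pos: "3 * K / (2 * \<delta>\<^sup>2) > 0" and r_pos: "6 / \<delta>\<^sup>2 > 0"
    using \<open>\<delta> > 0\<close> by auto
  have m: "real m \<ge> 3 * K / (2 * \<delta>\<^sup>2)" "real m \<le> 3 * K / (2 * \<delta>\<^sup>2) + 1"
    and r: "real r \<ge> 6 / \<delta>\<^sup>2" "real r \<le> 6 / \<delta>\<^sup>2 + 1"
    using m_pos r_pos unfolding m_def r_def by linarith+
  have "m > 0" using m m_pos by linarith
  have b: "mono_on {1..n} b"
    unfolding b_def using \<open>\<delta> > 0\<close> by (rule mono_on_log_bucket)
  have flatten: "d_TV n M (flatten b n M) \<le> \<delta>" if "M \<in> monotone_dists n" for M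
    using \<open>\<delta> > 0\<close> by (intro d_TV_flatten_le[OF that b]) (auto simp: b_def intro: log_bucket_gap)
  have "tolerant_monotonicity_tester n \<epsilon>\<^sub>1 \<epsilon>\<^sub>2 A"
    unfolding tolerant_monotonicity_tester_def
  proof (intro ballI conjI impI)
    fix D assume D: "D \<in> dists n"
    show "prob_output D A ACCEPT \<ge> 2/3" if "dist_monotone n D \<le> \<epsilon>\<^sub>1"
      unfolding A_def using assms
      by (intro tester_accepts[OF D _ \<open>\<delta> > 0\<close> r(1) \<open>m > 0\<close> m(1)[unfolded K_def] b flatten that]) auto
    show "prob_output D A REJECT \<ge> 2/3" if "dist_monotone n D > \<epsilon>\<^sub>2"
    proof -
      \<comment> \<open>The threshold \<open>3 * \<epsilon>\<^sub>1 + 7 * \<delta>\<close> plus the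
        margin \<open>\<delta>\<close> for rejection is at most \<open>\<epsilon>\<^sub>2\<close>;
        hence the 8 in the assumption.\<close>
      have "prob_output D A REJECT \<ge> 5/6"
        unfolding A_def using assms that by (intro tester_rejects[OF D \<open>\<delta> > 0\<close> r(1)]) auto
      then show ?thesis by simp
    qed
  qed
  moreover have "real m + 2 * real r \<le> 36 * ln (real n) / \<delta> ^ 3"
  proof -
    define L where "L = ln (real n)"
    have "ln 2 \<le> L" using \<open>n \<ge> 2\<close> by (simp add: L_def)
    then have "L \<ge> 1/2" using ln2_ge_two_thirds by linarith
    have K: "K \<le> 2 * L / \<delta> + 1"
      unfolding K_def b_def L_def using assms by (intro card_log_bucket_le) auto
    have "\<delta> ^ 3 \<le> 1" "\<delta> ^ 3 \<le> \<delta>\<^sup>2" "0 < \<delta> ^ 3"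
      using assms by (auto intro: power_le_one power_decreasing)
    have "K * \<delta> \<le> 2 * L + \<delta>"
      using K \<open>\<delta> > 0\<close> by (simp add: field_simps)
    then have "K * \<delta> \<le> 4 * L" using \<open>L \<ge> 1/2\<close> assms by linarith
    then have "3 * K / (2 * \<delta>\<^sup>2) \<le> 6 * L / \<delta> ^ 3"
      using \<open>\<delta> > 0\<close> by (simp add: field_simps power2_eq_square power3_eq_cube)
    moreover have "6 / \<delta>\<^sup>2 \<le> 12 * L / \<delta> ^ 3"
      using \<open>L \<ge> 1/2\<close> \<open>\<delta> ^ 3 \<le> \<delta>\<^sup>2\<close> \<open>0 < \<delta> ^ 3\<close> by (intro frac_le) auto
    moreover have "1 \<le> 2 * L / \<delta> ^ 3"
      using \<open>L \<ge> 1/2\<close> \<open>\<delta> ^ 3 \<le> 1\<close> \<open>0 < \<delta> ^ 3\<close> by (simp add: field_simps)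
    \<comment> \<open>The last term absorbs the roundings, one from \<open>m\<close> and two from
      \<open>2 * r\<close>; in total 6 + 24 + 6 = 36. Absorbing constants needs \<open>L\<close>
      bounded away from 0, that is, \<open>n\<close> at least 2.\<close>
    ultimately have "real m + 2 * real r \<le> 6 * L / \<delta> ^ 3 + 2 * (12 * L / \<delta> ^ 3) + 3 * (2 * L / \<delta> ^ 3)"
      using m r by linarith
    then show ?thesis by (simp add: L_def add_divide_distrib[symmetric])
  qed
  then have "queries_at_most n A (36 * ln (real n) / \<delta> ^ 3)"
    using queries_tester[of n b m r] assms unfolding A_def queries_at_most_def
    by (fastforce intro: order_trans)
  ultimately show ?thesis by blast
qed

section \<open>Degenerate parameters and the uniform constant\<close>

lemma dist_monotone_le_1:
  assumes "n \<ge> 1" "D \<in> dists n"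
  shows "dist_monotone n D \<le> 1"
  using dist_monotone_le[OF monotone_dists_nonempty] d_TV_le_1 monotone_dists_nonempty
    monotone_dists_subset assms by (meson order_trans)

text \<open>For \<open>n = 1\<close> the query bound is \<open>C * ln 1 = 0\<close>, so the tester
  must answer without queries; it can, since every distribution is monotone.\<close>

lemma dist_monotone_singleton:
  assumes "D \<in> dists 1"
  shows "dist_monotone 1 D \<le> 0"
proof -
  have "D \<in> monotone_dists 1"
    using assms by (auto simp: monotone_dists_def)
  from dist_monotone_le[OF this, of D] show ?thesis
    by (simp add: d_TV_def)
qed

theorem theoremB1:
  fixes \<gamma> :: real
  assumes "\<gamma> > 0"
  shows "\<exists>(T :: nat \<Rightarrow> real \<Rightarrow> real \<Rightarrow> dual_alg) (C :: real).
           C > 0 \<and>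
           (\<forall>(n::nat) (\<epsilon>\<^sub>1::real) (\<epsilon>\<^sub>2::real).
              n \<ge> 1 \<longrightarrow> 0 \<le> \<epsilon>\<^sub>1 \<longrightarrow> \<epsilon>\<^sub>1 < \<epsilon>\<^sub>2 \<longrightarrow> \<epsilon>\<^sub>2 > (3 + \<gamma>) * \<epsilon>\<^sub>1 \<longrightarrow>
                tolerant_monotonicity_tester n \<epsilon>\<^sub>1 \<epsilon>\<^sub>2 (T n \<epsilon>\<^sub>1 \<epsilon>\<^sub>2) \<and>
                queries_at_most n (T n \<epsilon>\<^sub>1 \<epsilon>\<^sub>2) (C * ln (real n) / \<epsilon>\<^sub>2 ^ 3))"
proof -
  \<comment> \<open>With \<open>\<delta> = c * \<epsilon>\<^sub>2\<close>, this value makes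
    \<open>3 * (\<epsilon>\<^sub>2 / (3 + \<gamma>)) + 8 * \<delta>\<close> equal to
    \<open>\<epsilon>\<^sub>2\<close>, so the whole gap is spent on the error terms.\<close>
  define c where "c = \<gamma> / (8 * (3 + \<gamma>))"
  have c: "0 < c" "c \<le> 1/2"
    using assms by (auto simp: c_def field_simps)
  define good where "good = (\<lambda>n \<epsilon>\<^sub>1 \<epsilon>\<^sub>2 A. tolerant_monotonicity_tester n \<epsilon>\<^sub>1 \<epsilon>\<^sub>2 A \<and>
    queries_at_most n A (36 / c ^ 3 * ln (real n) / \<epsilon>\<^sub>2 ^ 3))"
  have ex: "\<exists>A. good n \<epsilon>\<^sub>1 \<epsilon>\<^sub>2 A"
    if n: "n \<ge> 1" and \<epsilon>: "0 \<le> \<epsilon>\<^sub>1" "\<epsilon>\<^sub>1 < \<epsilon>\<^sub>2" and gap: "\<epsilon>\<^sub>2 > (3 + \<gamma>) * \<epsilon>\<^sub>1" for n \<epsilon>\<^sub>1 \<epsilon>\<^sub>2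
  proof (cases "n \<ge> 2 \<and> \<epsilon>\<^sub>2 \<le> 1")
    case True
    define \<delta> where "\<delta> = c * \<epsilon>\<^sub>2"
    have "\<epsilon>\<^sub>1 < \<epsilon>\<^sub>2 / (3 + \<gamma>)"
      using gap assms by (simp add: field_simps)
    moreover have "3 * (\<epsilon>\<^sub>2 / (3 + \<gamma>)) + 8 * \<delta> = \<epsilon>\<^sub>2"
    proof -
      have "3 * (\<epsilon>\<^sub>2 / (3 + \<gamma>)) + 8 * \<delta> = (3 * \<epsilon>\<^sub>2 + \<gamma> * \<epsilon>\<^sub>2) / (3 + \<gamma>)"
        using assms by (simp add: \<delta>_def c_def divide_simps) (simp add: algebra_simps)
      also have "\<dots> = \<epsilon>\<^sub>2"
        using assms by (simp add: field_simps)
      finally show ?thesis .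
    qed
    ultimately have "\<epsilon>\<^sub>2 \<ge> 3 * \<epsilon>\<^sub>1 + 8 * \<delta>" by linarith
    moreover have "0 < \<delta>" "\<delta> \<le> 1/2"
      using c \<epsilon> True mult_mono[of c "1/2" \<epsilon>\<^sub>2 1] by (auto simp: \<delta>_def)
    ultimately show ?thesis
      using tester_exists[of n \<delta> \<epsilon>\<^sub>1 \<epsilon>\<^sub>2] True by (auto simp: good_def \<delta>_def power_mult_distrib)
  next
    case False
    \<comment> \<open>Either \<open>n = 1\<close> or \<open>\<epsilon>\<^sub>2\<close> exceeds 1. No
      distribution is then farther than \<open>\<epsilon>\<^sub>2\<close> from monotone, and
      accepting without any query is correct.\<close>
    then have "dist_monotone n D \<le> \<epsilon>\<^sub>2" if "D \<in> dists n" for D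
      using dist_monotone_le_1[OF n that] dist_monotone_singleton[of D] that n \<epsilon>
      by (cases "n = 1") auto
    then have "good n \<epsilon>\<^sub>1 \<epsilon>\<^sub>2 (OUTPUT ACCEPT)"
      using n \<epsilon> c by (force simp: good_def tolerant_monotonicity_tester_def)
    then show ?thesis by blast
  qed
  \<comment> \<open>The tester may vary with \<open>n\<close>, \<open>\<epsilon>\<^sub>1\<close> and
    \<open>\<epsilon>\<^sub>2\<close>, while the constant \<open>36 / c ^ 3\<close> depends on
    \<open>\<gamma>\<close> only.\<close>
  define T where "T = (\<lambda>n \<epsilon>\<^sub>1 \<epsilon>\<^sub>2. SOME A. good n \<epsilon>\<^sub>1 \<epsilon>\<^sub>2 A)"
  have T: "tolerant_monotonicity_tester n \<epsilon>\<^sub>1 \<epsilon>\<^sub>2 (T n \<epsilon>\<^sub>1 \<epsilon>\<^sub>2) \<and>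
      queries_at_most n (T n \<epsilon>\<^sub>1 \<epsilon>\<^sub>2) (36 / c ^ 3 * ln (real n) / \<epsilon>\<^sub>2 ^ 3)"
    if "n \<ge> 1" "0 \<le> \<epsilon>\<^sub>1" "\<epsilon>\<^sub>1 < \<epsilon>\<^sub>2" "\<epsilon>\<^sub>2 > (3 + \<gamma>) * \<epsilon>\<^sub>1" for n \<epsilon>\<^sub>1 \<epsilon>\<^sub>2
    using someI_ex[OF ex[OF that]] unfolding T_def good_def .
  have "36 / c ^ 3 > 0" using c by simp
  then show ?thesis
    by (intro exI[of _ T] exI[of _ "36 / c ^ 3"] conjI[of "36 / c ^ 3 > 0"] allI impI T)
qed

end
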